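(* Every infinite group has an infinite countable subgroup which is weakly amenable.
   Context: A countable group $G$ is weakly amenable if either $G$ is finite, or there is an equivalence relation $\sim$ on $G$ such that (1) $G/\!\sim$ is infinite, and (2) for every $g\in G$ there is $b(g)\in\mathbb{N}$ such that for every class $C\in G/\!\sim$, $|\{C'\in G/\!\sim : gC\cap C'\neq\emptyset\}|\le b(g)$; and there is an increasing sequence of finite sets $A_n\subseteq G/\!\sim$ with $G/\!\sim\,=\bigcup_n A_n$ such that for every $g\in G$, $\lim_{n\to\infty} \frac{|\{C\in A_n : gC\subseteq \bigcup A_n\}|}{|A_n|}=1$, where $\bigcup A_n$ denotes the union of the classes in $A_n$. *)

theory Defs
  imports "HOL-Algebra.Coset" "HOL-Library.Countable_Set" Complex_Main
begin

text \<open>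
  The finiteness conjunct in the second condition is needed because \<^const>\<open>card\<close> of an
  infinite set is \<open>0\<close>. Since \<open>carrier G // r\<close> is infinite, \<open>A n\<close> is nonempty for all large
  \<open>n\<close>, so the value of the quotient for empty \<open>A n\<close> does not affect the limit.
\<close>

definition weakly_amenable :: "('a, 'b) monoid_scheme \<Rightarrow> bool" where
  "weakly_amenable G \<longleftrightarrow>
     group G \<and> countable (carrier G) \<and>
     (finite (carrier G) \<or>
      (\<exists>r. equiv (carrier G) r \<and>
           infinite (carrier G // r) \<and>
           (\<forall>g\<in>carrier G. \<exists>b::nat. \<forall>C\<in>carrier G // r.
              finite {C' \<in> carrier G // r. (g <#\<^bsub>G\<^esub> C) \<inter> C' \<noteq> {}} \<and>
              card {C' \<in> carrier G // r. (g <#\<^bsub>G\<^esub> C) \<inter> C' \<noteq> {}} \<le> b) \<and>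
           (\<exists>A :: nat \<Rightarrow> 'a set set.
              incseq A \<and> (\<forall>n. finite (A n)) \<and> (\<Union>n. A n) = carrier G // r \<and>
              (\<forall>g\<in>carrier G.
                 (\<lambda>n. real (card {C \<in> A n. g <#\<^bsub>G\<^esub> C \<subseteq> \<Union> (A n)}) / real (card (A n)))
                   \<longlonglongrightarrow> 1))))"

end

theory Submission
  imports Defs "HOL-Algebra.Generated_Groups"
begin

text \<open>
  The classes in the definition may be infinite and of unequal size, so a partition of a group into
  levels \<open>0, 1, 2, \<dots>\<close> that every left translation shifts by a bounded amount is a witness for weak
  amenability: the quotient then looks like \<open>\<nat>\<close>, exhausted by initial segments. If some finite
  set generates an infinite subgroup, word length provides the levels. Otherwise finitely
  generated subgroups are finite, there is a strictly increasing chain of finite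
  subgroups, and the level of an element of its union is the index at which it first appears.
\<close>

text \<open>The witness is the relation of having equal level. Its classes are the fibres of
  \<open>L\<close>, nonempty by surjectivity, so the quotient is indexed bijectively by the
  naturals. The bound \<open>m\<close> is uniform in \<open>x\<close>, so a translate of a fibre
  meets boundedly many fibres, and among the first \<open>n + 1\<close> fibres at most
  \<open>m\<close> can be moved out.\<close>

lemma weakly_amenable_if_level_function:
  fixes G :: "('a, 'b) monoid_scheme" (structure) and L :: "'a \<Rightarrow> nat"
  assumes "group G" and count: "countable (carrier G)"
    and surj: "L ` carrier G = UNIV"
    and shift: "\<And>g. g \<in> carrier G \<Longrightarrow> \<exists>m. \<forall>x\<in>carrier G. L (g \<otimes>\<^bsub>G\<^esub> x) \<le> L x + m"
  shows "weakly_amenable G"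
proof -
  interpret group G by fact
  define F where "F k = {x \<in> carrier G. L x = k}" for k
  define r where "r = {(x, y). x \<in> carrier G \<and> y \<in> carrier G \<and> L x = L y}"
  have F_nonempty: "F k \<noteq> {}" for k
    using surj unfolding F_def by (metis (mono_tags, lifting) UNIV_I empty_iff imageE mem_Collect_eq)
  have inj: "inj F"
    using F_nonempty by (fastforce simp: inj_def F_def)
  have equiv: "equiv (carrier G) r"
    by (rule equivI) (auto simp: r_def refl_on_def sym_def trans_def)
  have quot: "carrier G // r = range F"
  proof -
    have "r `` {x} = F (L x)" if "x \<in> carrier G" for x
      using that by (auto simp: r_def F_def)
    then have "carrier G // r = F ` L ` carrier G"
      by (auto simp: quotient_def)
    with surj show ?thesis by simp
  qed
  have infinite: "infinite (carrier G // r)"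
    using inj by (simp add: quot finite_image_iff)
  have bounded: "\<exists>b::nat. \<forall>C\<in>carrier G // r.
      finite {C' \<in> carrier G // r. (g <# C) \<inter> C' \<noteq> {}} \<and>
      card {C' \<in> carrier G // r. (g <# C) \<inter> C' \<noteq> {}} \<le> b" if g: "g \<in> carrier G" for g
  proof -
    obtain m where m: "\<And>x. x \<in> carrier G \<Longrightarrow> L (g \<otimes> x) \<le> L x + m"
      using shift[OF g] by blast
    obtain m' where m': "\<And>x. x \<in> carrier G \<Longrightarrow> L (inv g \<otimes> x) \<le> L x + m'"
      using shift[OF inv_closed[OF g]] by blast
    \<comment> \<open>The shift hypothesis limits only how far a level can rise. Applied to
      \<open>inv g\<close> at the point \<open>g \<otimes> x\<close>, it limits how far
      \<open>g\<close> can lower a level.\<close>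
    have lower: "L x \<le> L (g \<otimes> x) + m'" if "x \<in> carrier G" for x
      using m'[of "g \<otimes> x"] that g by (simp add: m_assoc[symmetric])
    have sub: "{C' \<in> carrier G // r. (g <# F k) \<inter> C' \<noteq> {}} \<subseteq> F ` {k - m'..k + m}" for k
    proof
      fix C' assume "C' \<in> {C' \<in> carrier G // r. (g <# F k) \<inter> C' \<noteq> {}}"
      then obtain j x where "C' = F j" "x \<in> F k" "g \<otimes> x \<in> F j"
        by (auto simp: quot l_coset_def)
      moreover from this have "j \<le> k + m" "k \<le> j + m'"
        using m[of x] lower[of x] by (auto simp: F_def)
      ultimately show "C' \<in> F ` {k - m'..k + m}" by auto
    qed
    have "card (F ` {k - m'..k + m}) \<le> m + m' + 1" for k
      using card_image_le[of "{k - m'..k + m}" F] by simp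
    then have "finite {C' \<in> carrier G // r. (g <# F k) \<inter> C' \<noteq> {}} \<and>
        card {C' \<in> carrier G // r. (g <# F k) \<inter> C' \<noteq> {}} \<le> m + m' + 1" for k
      using finite_subset[OF sub[of k]] card_mono[OF _ sub[of k]]
      by (meson finite_atLeastAtMost finite_imageI order_trans)
    then show ?thesis by (auto simp: quot)
  qed
  define A where "A n = F ` {..n}" for n
  have incseq: "incseq A" by (auto simp: incseq_def A_def)
  have fin: "finite (A n)" for n by (simp add: A_def)
  have union: "(\<Union>n. A n) = carrier G // r" by (auto simp: A_def quot)
  have cardA: "card (A n) = n + 1" for n
    using inj by (simp add: A_def card_image inj_on_subset)
  have lim: "(\<lambda>n. real (card {C \<in> A n. g <# C \<subseteq> \<Union> (A n)}) / real (card (A n)))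
      \<longlonglongrightarrow> 1" if g: "g \<in> carrier G" for g
  proof -
    obtain m where m: "\<And>x. x \<in> carrier G \<Longrightarrow> L (g \<otimes> x) \<le> L x + m"
      using shift[OF g] by blast
    let ?c = "\<lambda>n. card {C \<in> A n. g <# C \<subseteq> \<Union> (A n)}"
    have upper: "?c n \<le> n + 1" for n
      using card_mono[OF fin[of n], of "{C \<in> A n. g <# C \<subseteq> \<Union> (A n)}"] by (simp add: cardA)
    have lower: "n + 1 \<le> ?c n + m" for n
    proof -
      \<comment> \<open>For \<open>k + m \<le> n\<close> the translate of \<open>F k\<close> stays
        within levels at most \<open>n\<close>. If \<open>m > n\<close>, the truncated subtraction
        makes the index set empty and the bound to be shown is trivial.\<close>
      have "F ` {..<n + 1 - m} \<subseteq> {C \<in> A n. g <# C \<subseteq> \<Union> (A n)}"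
      proof
        fix C assume "C \<in> F ` {..<n + 1 - m}"
        then obtain k where k: "k < n + 1 - m" "C = F k" by blast
        have "g \<otimes> x \<in> \<Union> (A n)" if "x \<in> F k" for x
        proof -
          from that have "x \<in> carrier G" "L x = k" by (auto simp: F_def)
          with m[of x] k(1) g show ?thesis by (auto simp: A_def F_def)
        qed
        with k show "C \<in> {C \<in> A n. g <# C \<subseteq> \<Union> (A n)}"
          by (auto simp: A_def l_coset_def)
      qed
      then have "card (F ` {..<n + 1 - m}) \<le> ?c n"
        by (rule card_mono[rotated]) (simp add: fin)
      then show ?thesis
        using inj by (simp add: card_image inj_on_subset)
    qed
    \<comment> \<open>As \<open>A n\<close> has \<open>n + 1\<close> elements, the ratio is squeezed
      between \<open>1 - m / (n + 1)\<close> and \<open>1\<close>.\<close>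
    have "(\<lambda>n. 1 - real m * inverse (real (Suc n))) \<longlonglongrightarrow> 1 - real m * 0"
      by (intro tendsto_intros LIMSEQ_inverse_real_of_nat)
    then have lim_lower: "(\<lambda>n. 1 - real m * inverse (real (Suc n))) \<longlonglongrightarrow> 1" by simp
    have ratio_ge: "\<forall>n. 1 - real m * inverse (real (Suc n)) \<le> real (?c n) / real (card (A n))"
    proof
      fix n
      have "real (n + 1) \<le> real (?c n) + real m"
        using lower[of n] by (metis of_nat_add of_nat_le_iff)
      then show "1 - real m * inverse (real (Suc n)) \<le> real (?c n) / real (card (A n))"
        unfolding cardA using divide_right_mono[of "real (n + 1) - real m" "real (?c n)" "real (n + 1)"]
        by (simp add: diff_divide_distrib flip: divide_inverse)
    qed
    have ratio_le: "\<forall>n. real (?c n) / real (card (A n)) \<le> 1"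
      using upper unfolding cardA by (simp add: field_simps del: of_nat_add of_nat_Suc)
    show ?thesis
      by (rule tendsto_sandwich[OF always_eventually[OF ratio_ge] always_eventually[OF ratio_le]
            lim_lower tendsto_const])
  qed
  show ?thesis
    unfolding weakly_amenable_def
    by (intro conjI disjI2 exI[of _ r] exI[of _ A] ballI allI is_group count equiv infinite
        bounded incseq fin union lim)
qed

text \<open>The level of \<open>x\<close> is the first index \<open>n\<close> with \<open>x\<close>
  in \<open>B n\<close>. Strict growth leaves no level empty, and the shift condition says that
  \<open>g\<close> raises levels by at most \<open>m\<close>.\<close>

lemma weakly_amenable_if_filtration:
  fixes G :: "('a, 'b) monoid_scheme" and B :: "nat \<Rightarrow> 'a set"
  assumes "group G" and count: "countable (carrier G)"
    and strict: "\<And>n. B n \<subset> B (Suc n)" and nonempty: "B 0 \<noteq> {}"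
    and union: "(\<Union>n. B n) = carrier G"
    and shift: "\<And>g. g \<in> carrier G \<Longrightarrow> \<exists>m. \<forall>n. \<forall>x\<in>B n. g \<otimes>\<^bsub>G\<^esub> x \<in> B (n + m)"
  shows "weakly_amenable G"
proof (rule weakly_amenable_if_level_function)
  define L where "L x = (LEAST n. x \<in> B n)" for x
  have L_mem: "x \<in> B (L x)" if "x \<in> carrier G" for x
    using that union unfolding L_def by (auto intro: LeastI)
  have L_le: "L x \<le> n" if "x \<in> B n" for x n
    using that unfolding L_def by (rule Least_le)
  have mono: "B m \<subseteq> B n" if "m \<le> n" for m n
    using lift_Suc_mono_le[of B, OF psubset_imp_subset[OF strict] that] .
  have "\<exists>x\<in>carrier G. L x = n" for n
  proof (cases n)
    case 0
    obtain x where x: "x \<in> B 0" using nonempty by blast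
    then have "x \<in> carrier G" using union by blast
    with 0 L_le[OF x] show ?thesis by auto
  next
    case (Suc k)
    obtain x where x: "x \<in> B (Suc k)" "x \<notin> B k" using strict[of k] by blast
    then have "x \<in> carrier G" using union by blast
    \<comment> \<open>A point that is new in \<open>B (Suc k)\<close> lies in no earlier set by
      monotonicity, so its level is exactly \<open>Suc k\<close>.\<close>
    moreover have "\<not> L x \<le> k"
      using x(2) L_mem[OF \<open>x \<in> carrier G\<close>] mono by blast
    ultimately show ?thesis using Suc L_le[OF x(1)] by (intro bexI[of _ x]) auto
  qed
  then show "L ` carrier G = UNIV" by (auto simp: image_iff) metis
  show "\<exists>m. \<forall>x\<in>carrier G. L (g \<otimes>\<^bsub>G\<^esub> x) \<le> L x + m" if g: "g \<in> carrier G" for g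
  proof -
    obtain m where "\<forall>n. \<forall>x\<in>B n. g \<otimes>\<^bsub>G\<^esub> x \<in> B (n + m)" using shift[OF g] by blast
    then show ?thesis using L_mem L_le by (intro exI[of _ m]) auto
  qed
qed (fact assms)+

context group
begin

text \<open>These are products of exactly \<open>n\<close> factors from \<open>T\<close>. They are
  balls for word length once \<open>T\<close> contains \<open>\<one>\<close>, which pads shorter
  words.\<close>

primrec word_ball :: "'a set \<Rightarrow> nat \<Rightarrow> 'a set" where
  "word_ball T 0 = {\<one>}"
| "word_ball T (Suc n) = T <#> word_ball T n"

lemma word_ball_subset_generate:
  "word_ball T n \<subseteq> generate G T"
  by (induction n) (auto simp: set_mult_def intro: generate.intros)

lemma finite_word_ball: "finite T \<Longrightarrow> finite (word_ball T n)"
  by (induction n) (auto simp: set_mult_def)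

text \<open>Concatenation of words, by peeling off the leftmost factor. It makes left translation by
  an element of the \<open>m\<close>-th ball a shift by \<open>m\<close>.\<close>

lemma word_ball_mult:
  assumes T: "T \<subseteq> carrier G" and "x \<in> word_ball T m" and y: "y \<in> word_ball T n"
  shows "x \<otimes> y \<in> word_ball T (m + n)"
proof -
  have carr: "word_ball T k \<subseteq> carrier G" for k
    using word_ball_subset_generate generate_in_carrier[OF T] by blast
  from assms(2) show ?thesis
  proof (induction m arbitrary: x)
    case 0
    moreover have "y \<in> carrier G" using y carr by blast
    ultimately show ?case using y by simp
  next
    case (Suc m)
    then obtain t z where tz: "x = t \<otimes> z" "t \<in> T" "z \<in> word_ball T m"
      by (auto simp: set_mult_def)
    then have "x \<otimes> y = t \<otimes> (z \<otimes> y)"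
      using T carr y by (auto intro!: m_assoc)
    with Suc.IH[OF tz(3)] tz(2) show ?case by (auto simp: set_mult_def)
  qed
qed

text \<open>Closure under inverses turns every inverse of a generator into a word of length one;
  concatenation then handles products.\<close>

lemma Union_word_ball_eq_generate:
  assumes T: "T \<subseteq> carrier G" and inv: "\<And>t. t \<in> T \<Longrightarrow> inv t \<in> T"
  shows "(\<Union>n. word_ball T n) = generate G T"
proof
  have ball1: "t \<in> word_ball T (Suc 0)" if "t \<in> T" for t
    using that T by (force simp: set_mult_def)
  have "x \<in> (\<Union>n. word_ball T n)" if "x \<in> generate G T" for x
    using that
  proof induction
    case one
    then show ?case by (intro UN_I[of 0]) auto
  next
    case (incl h)
    then show ?case using ball1 by blast
  next
    case (inv h)
    then show ?case using ball1 assms(2) by blast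
  next
    case (eng h1 h2)
    then show ?case using word_ball_mult[OF T] by blast
  qed
  then show "generate G T \<subseteq> (\<Union>n. word_ball T n)" by blast
qed (use word_ball_subset_generate in blast)

text \<open>The word balls are finite and exhaust an infinite subgroup, so they can never stop
  growing and form a strict filtration.\<close>

lemma infinite_finitely_generated_imp_weakly_amenable_subgroup:
  assumes S: "S \<subseteq> carrier G" "finite S" and inf: "infinite (generate G S)"
  shows "\<exists>H. subgroup H G \<and> infinite H \<and> countable H \<and> weakly_amenable (G\<lparr>carrier := H\<rparr>)"
proof -
  \<comment> \<open>Inverses make the balls exhaust the generated subgroup, and
    \<open>\<one>\<close> makes them nested; \<open>T\<close> stays finite.\<close>
  define T where "T = insert \<one> (S \<union> m_inv G ` S)"
  have T: "T \<subseteq> carrier G" "finite T" and inv: "\<And>t. t \<in> T \<Longrightarrow> inv t \<in> T" and one: "\<one> \<in> T"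
    using S by (auto simp: T_def)
  let ?H = "generate G T" and ?B = "word_ball T"
  have sg: "subgroup ?H G" using T(1) by (rule generate_is_subgroup)
  have union: "(\<Union>n. ?B n) = ?H" using Union_word_ball_eq_generate[OF T(1) inv] .
  have "generate G S \<subseteq> ?H" by (rule mono_generate) (auto simp: T_def)
  then have infH: "infinite ?H" using inf finite_subset by blast
  have countH: "countable ?H"
    unfolding union[symmetric] by (intro countable_UN) (auto intro: countable_finite finite_word_ball T)
  have mono: "?B n \<subseteq> ?B (Suc n)" for n
    using one word_ball_subset_generate[of T n] generate_in_carrier[OF T(1)]
    by (force simp: set_mult_def)
  have "?B n \<noteq> ?B (Suc n)" for n
  proof
    assume eq: "?B n = ?B (Suc n)"
    \<comment> \<open>Each ball is determined by its predecessor, so a single repetition makes the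
      sequence constant from there on.\<close>
    have stable: "?B (n + k) = ?B n" for k
      by (induction k) (simp_all add: eq[symmetric, unfolded word_ball.simps])
    have "?B k \<subseteq> ?B n" for k
      using stable[of k] lift_Suc_mono_le[of ?B k "n + k"] mono by simp
    then have "?H = ?B n" using union by blast
    with infH finite_word_ball[OF T(2)] show False by simp
  qed
  then have strict: "?B n \<subset> ?B (Suc n)" for n using mono by blast
  have "weakly_amenable (G\<lparr>carrier := ?H\<rparr>)"
  proof (rule weakly_amenable_if_filtration[of _ ?B])
    show "group (G\<lparr>carrier := ?H\<rparr>)" using sg subgroup_imp_group by blast
    show "\<exists>m. \<forall>n. \<forall>x\<in>?B n. g \<otimes>\<^bsub>G\<lparr>carrier := ?H\<rparr>\<^esub> x \<in> ?B (n + m)"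
      if "g \<in> carrier (G\<lparr>carrier := ?H\<rparr>)" for g
    proof -
      from that obtain m where "g \<in> ?B m" using union by auto
      then have "g \<otimes> x \<in> ?B (n + m)" if "x \<in> ?B n" for x n
        using word_ball_mult[OF T(1) _ that] by (metis add.commute)
      then show ?thesis by auto
    qed
    show "countable (carrier (G\<lparr>carrier := ?H\<rparr>))" using countH by simp
    show "?B n \<subset> ?B (Suc n)" for n by (rule strict)
  qed (simp_all add: union)
  with sg infH countH show ?thesis by blast
qed

text \<open>Adjoining an outside element to a finite subgroup generates a larger finite subgroup,
  which gives a strict chain. Its union is filtered by the chain itself.\<close>

lemma locally_finite_imp_weakly_amenable_subgroup:
  assumes inf: "infinite (carrier G)"
    and fin: "\<And>S. S \<subseteq> carrier G \<Longrightarrow> finite S \<Longrightarrow> finite (generate G S)"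
  shows "\<exists>H. subgroup H G \<and> infinite H \<and> countable H \<and> weakly_amenable (G\<lparr>carrier := H\<rparr>)"
proof -
  have "\<exists>K. \<forall>n. (subgroup (K n) G \<and> finite (K n)) \<and> K n \<subset> K (Suc n)"
  proof (rule dependent_nat_choice)
    show "\<exists>K. subgroup K G \<and> finite K"
      using triv_subgroup by blast
    fix K assume K: "subgroup K G \<and> finite K"
    then obtain x where x: "x \<in> carrier G" "x \<notin> K"
      using inf by (metis finite_subset subsetI)
    have sub: "insert x K \<subseteq> carrier G" using x K subgroup.subset by blast
    moreover have "insert x K \<subseteq> generate G (insert x K)" by (auto intro: generate.incl)
    ultimately show "\<exists>K'. (subgroup K' G \<and> finite K') \<and> K \<subset> K'"
      using x K fin[OF sub] generate_is_subgroup[OF sub] by (intro exI[of _ "generate G (insert x K)"]) auto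
  qed
  then obtain K where sgK: "\<And>n. subgroup (K n) G" and finK: "\<And>n. finite (K n)"
    and strict: "\<And>n. K n \<subset> K (Suc n)" by blast
  let ?H = "\<Union>n. K n"
  have mono: "K m \<subseteq> K n" if "m \<le> n" for m n
    using lift_Suc_mono_le[of K, OF psubset_imp_subset[OF strict] that] .
  \<comment> \<open>The index \<open>n + m\<close> dominates both \<open>m\<close> and
    \<open>n\<close>, so both factors lie in the single subgroup \<open>K (n + m)\<close>. This is
    the shift condition for the chain.\<close>
  have mult: "x \<otimes> y \<in> K (n + m)" if "x \<in> K m" "y \<in> K n" for x y m n
    using that mono[of m "n + m"] mono[of n "n + m"] by (intro subgroup.m_closed[OF sgK]) auto
  have sg: "subgroup ?H G"
  proof (rule subgroupI)
    show "?H \<subseteq> carrier G" using sgK subgroup.subset by blast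
    show "?H \<noteq> {}" using sgK subgroup.one_closed by blast
    show "inv x \<in> ?H" if "x \<in> ?H" for x
      using that subgroup.m_inv_closed[OF sgK] by auto
    show "x \<otimes> y \<in> ?H" if "x \<in> ?H" "y \<in> ?H" for x y
      using that mult by (meson UN_E UN_I UNIV_I)
  qed
  have infH: "infinite ?H"
  proof
    assume "finite ?H"
    \<comment> \<open>The \<open>K n\<close> are infinitely many distinct subsets of the union,
      whereas a finite set has a finite power set.\<close>
    moreover have "inj K" using strict by (intro strict_mono_imp_inj_on) (simp add: strict_mono_Suc_iff)
    ultimately show False
      using finite_subset[of "range K" "Pow ?H"] finite_imageD[of K UNIV] by auto
  qed
  have countH: "countable ?H"
    by (intro countable_UN) (auto intro: countable_finite finK)
  have "weakly_amenable (G\<lparr>carrier := ?H\<rparr>)"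
  proof (rule weakly_amenable_if_filtration[of _ K])
    show "group (G\<lparr>carrier := ?H\<rparr>)" using sg subgroup_imp_group by blast
    show "K 0 \<noteq> {}" using sgK subgroup.one_closed by blast
    show "\<exists>m. \<forall>n. \<forall>x\<in>K n. g \<otimes>\<^bsub>G\<lparr>carrier := ?H\<rparr>\<^esub> x \<in> K (n + m)"
      if "g \<in> carrier (G\<lparr>carrier := ?H\<rparr>)" for g
    proof -
      from that obtain m where "g \<in> K m" by auto
      with mult show ?thesis by (intro exI[of _ m]) simp
    qed
    show "countable (carrier (G\<lparr>carrier := ?H\<rparr>))" using countH by simp
  qed (simp_all add: strict)
  with sg infH countH show ?thesis by blast
qed

end

theorem theorem2p5:
  fixes G :: "('a, 'b) monoid_scheme"
  assumes "group G" and "infinite (carrier G)"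
  shows "\<exists>H. subgroup H G \<and> infinite H \<and> countable H \<and> weakly_amenable (G\<lparr>carrier := H\<rparr>)"
proof (cases "\<exists>S \<subseteq> carrier G. finite S \<and> infinite (generate G S)")
  case True
  then obtain S where "S \<subseteq> carrier G" "finite S" "infinite (generate G S)" by blast
  with assms(1) show ?thesis by (rule group.infinite_finitely_generated_imp_weakly_amenable_subgroup)
next
  case False
  show ?thesis
    by (rule group.locally_finite_imp_weakly_amenable_subgroup[OF assms]) (use False in blast)
qed

end
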